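(* Let $q\in(0,1)$ and $b>0$. Let $f:[0,b]\to\mathbb{R}$ be a continuous convex function. Then $$f\left(\frac{b}{[2]_q}\right)\le\frac1b I_q(f;0,b)\le\frac{1}{[2]_q}\bigl(q\,f(0)+f(b)\bigr).$$
   Context: For $q\in(0,1)$ and $b>0$, $I_q(f;0,b)=b(1-q)\sum_{k=0}^{\infty}f(bq^k)q^k$. Also $[2]_q=1+q$. *)

theory Defs
  imports "HOL-Analysis.Analysis"
begin

text \<open>The \<open>q\<close>-analogue \<open>[2]\<^sub>q\<close> of the number 2.\<close>
definition q_two :: "real \<Rightarrow> real"
  where "q_two q = 1 + q"

text \<open>
  The Jackson integral \<open>I\<^sub>q(f; 0, b)\<close>. As usual for \<open>suminf\<close>, the value is meaningful
  only when the series converges; for \<open>0 < q < 1\<close>, \<open>b > 0\<close> and \<open>f\<close> continuous on \<open>[0, b]\<close>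
  it does, see \<open>summable_q_integral\<close> below.
\<close>
definition q_integral :: "real \<Rightarrow> (real \<Rightarrow> real) \<Rightarrow> real \<Rightarrow> real"
  where "q_integral q f b = b * (1 - q) * (\<Sum>k. f (b * q ^ k) * q ^ k)"

lemma summable_q_integral:
  assumes q: "0 < q" "q < 1" and b: "0 < b" and f: "continuous_on {0..b} f"
  shows "summable (\<lambda>k. f (b * q ^ k) * q ^ k :: real)"
proof -
  have "bounded (f ` {0..b})"
    using f by (intro compact_imp_bounded compact_continuous_image) auto
  then obtain B where B: "\<And>x. x \<in> {0..b} \<Longrightarrow> norm (f x) \<le> B"
    unfolding bounded_iff by blast
  show ?thesis
  proof (rule summable_comparison_test')
    show "summable (\<lambda>k. B * q ^ k)"
      using q by (intro summable_mult summable_geometric) auto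
    fix k :: nat
    have "b * q ^ k \<in> {0..b}"
      using q b by (auto intro!: mult_left_le power_le_one)
    from B[OF this] show "norm (f (b * q ^ k) * q ^ k) \<le> B * q ^ k"
      using q by (simp add: abs_mult mult_right_mono)
  qed
qed

end

theory Submission
  imports Defs
begin

text \<open>
  The functional \<open>f \<mapsto> I\<^sub>q(f; 0, b) / b\<close> averages \<open>f\<close> over the points \<open>b q\<^sup>k\<close> with the
  nonnegative weights \<open>(1 - q) q\<^sup>k\<close>, which add up to 1. Hence it is monotone, and the two
  geometric series with ratios \<open>q\<close> and \<open>q\<^sup>2\<close> show that it sends an affine function to its
  value at \<open>c = b / (1 + q)\<close>.

  Both inequalities follow by comparing \<open>f\<close> with an affine function: on \<open>[0, b]\<close> the convex
  function \<open>f\<close> lies above a supporting line at the interior point \<open>c\<close>, whose value there is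
  \<open>f c\<close>, and below its chord, whose value at \<open>c\<close> is \<open>(q f(0) + f(b)) / (1 + q)\<close>.
\<close>

lemma q_mean_affine:
  fixes q b s t :: real
  assumes q: "0 < q" "q < 1" and b: "0 < b"
  shows "1 / b * q_integral q (\<lambda>x. s + t * x) b = s + t * (b / q_two q)"
proof -
  have "\<bar>q\<^sup>2\<bar> < 1"
    using q by (simp add: power_less_one_iff)
  then have "(\<lambda>k. s * q ^ k + t * b * (q\<^sup>2) ^ k)
      sums (s * (1 / (1 - q)) + t * b * (1 / (1 - q\<^sup>2)))"
    using q by (intro sums_add sums_mult geometric_sums) auto
  moreover have "s * q ^ k + t * b * (q\<^sup>2) ^ k = (s + t * (b * q ^ k)) * q ^ k" for k
    by (simp add: algebra_simps power2_eq_square power_mult_distrib)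
  ultimately have "(\<Sum>k. (s + t * (b * q ^ k)) * q ^ k)
      = s * (1 / (1 - q)) + t * b * (1 / (1 - q\<^sup>2))"
    by (simp add: sums_iff)
  then have "1 / b * q_integral q (\<lambda>x. s + t * x) b
      = s + t * b * ((1 - q) / (1 - q\<^sup>2))"
    using q b by (simp add: q_integral_def distrib_left mult_ac)
  moreover have "1 - q\<^sup>2 = (1 - q) * (1 + q)"
    by (simp add: algebra_simps power2_eq_square)
  then have "(1 - q) / (1 - q\<^sup>2) = 1 / (1 + q)"
    using q by (metis diff_gt_0_iff_gt less_irrefl mult_cancel_left1 nonzero_divide_mult_cancel_left)
  ultimately show ?thesis
    by (simp add: q_two_def)
qed

lemma q_integral_mono:
  fixes q b :: real
  assumes q: "0 < q" "q < 1" and b: "0 < b"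
    and f: "continuous_on {0..b} f" and g: "continuous_on {0..b} g"
    and le: "\<And>x. x \<in> {0..b} \<Longrightarrow> f x \<le> g x"
  shows "q_integral q f b \<le> q_integral q g b"
proof -
  have "f (b * q ^ k) * q ^ k \<le> g (b * q ^ k) * q ^ k" for k
    using q b by (intro mult_right_mono le) (auto intro!: mult_left_le power_le_one)
  then have "(\<Sum>k. f (b * q ^ k) * q ^ k) \<le> (\<Sum>k. g (b * q ^ k) * q ^ k)"
    using q b f g by (intro suminf_le summable_q_integral)
  then show ?thesis
    unfolding q_integral_def using q b by (intro mult_left_mono) auto
qed

theorem theorem5p2:
  fixes q b :: real and f :: "real \<Rightarrow> real"
  assumes "q \<in> {0<..<1}" and "b > 0"
    and "continuous_on {0..b} f" and "convex_on {0..b} f"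
  shows "f (b / q_two q) \<le> 1 / b * q_integral q f b
    \<and> 1 / b * q_integral q f b \<le> 1 / q_two q * (q * f 0 + f b)"
proof
  have q: "0 < q" "q < 1"
    using assms(1) by auto
  define c where "c = b / q_two q"
  have c: "0 < c" "c < b"
    using q \<open>b > 0\<close> by (auto simp: c_def q_two_def field_simps)
  have affine: "1 / b * q_integral q (\<lambda>x. s + t * x) b = s + t * c" for s t
    unfolding c_def using q \<open>b > 0\<close> by (rule q_mean_affine)
  show "f (b / q_two q) \<le> 1 / b * q_integral q f b"
  proof -
    \<comment> \<open>slope of a supporting line at \<open>c\<close>\<close>
    define m where "m = Inf ((\<lambda>t. (f c - f t) / (c - t)) ` ({c<..} \<inter> {0..b}))"
    have "f c + m * (x - c) \<le> f x" if "x \<in> {0..b}" for x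
      unfolding m_def using assms(4) _ that
      by (rule convex_le_Inf_differential) (use c in auto)
    then have "q_integral q (\<lambda>x. (f c - m * c) + m * x) b \<le> q_integral q f b"
      using q assms
      by (intro q_integral_mono) (auto intro!: continuous_intros simp: algebra_simps)
    then have "1 / b * q_integral q (\<lambda>x. (f c - m * c) + m * x) b
        \<le> 1 / b * q_integral q f b"
      using \<open>b > 0\<close> by (intro mult_left_mono) auto
    then show ?thesis
      unfolding affine by (simp add: c_def)
  qed
  show "1 / b * q_integral q f b \<le> 1 / q_two q * (q * f 0 + f b)"
  proof -
    define m where "m = (f b - f 0) / b"
    have "f x \<le> f 0 + m * x" if "x \<in> {0..b}" for x
      using convex_onD_Icc'[OF assms(4) that] by (simp add: m_def add.commute)
    then have "q_integral q f b \<le> q_integral q (\<lambda>x. f 0 + m * x) b"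
      using q assms by (intro q_integral_mono) (auto intro!: continuous_intros)
    then have "1 / b * q_integral q f b \<le> 1 / b * q_integral q (\<lambda>x. f 0 + m * x) b"
      using \<open>b > 0\<close> by (intro mult_left_mono) auto
    also have "\<dots> = 1 / q_two q * (q * f 0 + f b)"
    proof -
      have "m * c = (f b - f 0) / (1 + q)" "1 + q \<noteq> 0"
        using q \<open>b > 0\<close> by (simp_all add: m_def c_def q_two_def)
      then show ?thesis
        unfolding affine by (simp add: q_two_def field_simps)
    qed
    finally show ?thesis .
  qed
qed

end
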